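(* Let $M\subset\mathbb{R}^3$ be an open neighborhood of $0$ with coordinates $(x,y,z)$, let $f:M\to\mathbb{R}^2$ be a $C^\infty$ map, and let $D_1\subset TM$ be the contact structure spanned by $e_1=\partial_x$ and $e_2=\partial_y-x\partial_z$. Let $\varphi:D_1\to f^*T\mathbb{R}^2$, $\varphi(v)=df(v)$, be the bundle homomorphism induced by $f$, let $\lambda=\lambda_\varphi=\det(f_x,\,f_y-xf_z)$, let $S=\{\lambda=0\}$ be the set of singular points of $\varphi$, and let $$X=(\lambda_y-x\lambda_z)\partial_x-\lambda_x\partial_y-(\lambda-x\lambda_x)\partial_z$$ be the Hamilton vector field of $\lambda$. Suppose that $p\in S$ is a corank one singular point of $\varphi$, and let $\eta_\varphi$ be a null section of $\varphi$ near $p$. Then $p$ is a fold-like singular point of $\varphi$ if and only if $X_p$ and $(\eta_\varphi)_p$ are linearly independent.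
   Context: Subscripts $x,y,z$ denote partial derivatives. A point $p$ is a singular point of $\varphi$ if $\operatorname{rank}\varphi_p<2$, and a corank one singular point if $\operatorname{rank}\varphi_p=1$. A null section of $\varphi$ near a corank one singular point $p$ is a smooth section $\eta_\varphi$ of $D_1$ on a neighborhood $U$ of $p$ such that $(\eta_\varphi)_q$ generates $\ker\varphi_q$ for every $q\in S\cap U$. A singular point $p$ is fold-like if it is of corank one and $\eta_\varphi\lambda_\varphi(p)\neq0$, where $\eta_\varphi\lambda_\varphi$ is the directional derivative of $\lambda_\varphi$ by $\eta_\varphi$. *)

theory Defs
  imports "HOL-Analysis.Analysis"
begin

text \<open>
  Maps defined on an open set \<open>M\<close> are total functions whose values outside \<open>M\<close> are irrelevant.
  \<open>Ck_on k M g\<close> is meant for open \<open>M\<close>: all iterated directional derivatives of \<open>g\<close> of order at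
  most \<open>k\<close> exist and are continuous on \<open>M\<close>.
\<close>

fun Ck_on :: "nat \<Rightarrow> 'a::real_normed_vector set \<Rightarrow> ('a \<Rightarrow> 'b::real_normed_vector) \<Rightarrow> bool" where
  "Ck_on 0 M g \<longleftrightarrow> continuous_on M g"
| "Ck_on (Suc k) M g \<longleftrightarrow> (\<forall>q\<in>M. g differentiable (at q)) \<and>
     (\<forall>v. Ck_on k M (\<lambda>q. frechet_derivative g (at q) v))"

definition smooth_on :: "'a::real_normed_vector set \<Rightarrow> ('a \<Rightarrow> 'b::real_normed_vector) \<Rightarrow> bool" where
  "smooth_on M g \<longleftrightarrow> (\<forall>k. Ck_on k M g)"

text \<open>The coordinates \<open>x, y, z\<close> of a point \<open>q\<close> are \<open>q $ 1, q $ 2, q $ 3\<close>.\<close>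

abbreviation dx :: "real^3" where "dx \<equiv> axis 1 1"
abbreviation dy :: "real^3" where "dy \<equiv> axis 2 1"
abbreviation dz :: "real^3" where "dz \<equiv> axis 3 1"

definition partial :: "3 \<Rightarrow> (real^3 \<Rightarrow> 'b::real_normed_vector) \<Rightarrow> real^3 \<Rightarrow> 'b" where
  "partial i g q = frechet_derivative g (at q) (axis i 1)"

definition e1 :: "real^3 \<Rightarrow> real^3" where
  "e1 q = dx"

definition e2 :: "real^3 \<Rightarrow> real^3" where
  "e2 q = dy - q $ 1 *\<^sub>R dz"

definition D1 :: "real^3 \<Rightarrow> (real^3) set" where
  "D1 q = span {e1 q, e2 q}"

text \<open>
  \<open>phi f q\<close> is the bundle homomorphism on the fibre over \<open>q\<close>; only its restriction to \<open>D1 q\<close>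
  is meaningful, so kernel and rank are taken on \<open>D1 q\<close>.
\<close>

definition phi :: "(real^3 \<Rightarrow> real^2) \<Rightarrow> real^3 \<Rightarrow> real^3 \<Rightarrow> real^2" where
  "phi f q v = frechet_derivative f (at q) v"

definition ker_phi :: "(real^3 \<Rightarrow> real^2) \<Rightarrow> real^3 \<Rightarrow> (real^3) set" where
  "ker_phi f q = {v \<in> D1 q. phi f q v = 0}"

definition rank_phi :: "(real^3 \<Rightarrow> real^2) \<Rightarrow> real^3 \<Rightarrow> nat" where
  "rank_phi f q = dim (phi f q ` D1 q)"

definition lam :: "(real^3 \<Rightarrow> real^2) \<Rightarrow> real^3 \<Rightarrow> real" where
  "lam f q = det (transpose (vector
     [partial 1 f q, partial 2 f q - q $ 1 *\<^sub>R partial 3 f q] :: real^2^2))"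

definition Sing :: "(real^3) set \<Rightarrow> (real^3 \<Rightarrow> real^2) \<Rightarrow> (real^3) set" where
  "Sing M f = {q \<in> M. lam f q = 0}"

definition corank_one_singular :: "(real^3) set \<Rightarrow> (real^3 \<Rightarrow> real^2) \<Rightarrow> real^3 \<Rightarrow> bool" where
  "corank_one_singular M f p \<longleftrightarrow> p \<in> M \<and> rank_phi f p = 1"

text \<open>\<open>eta\<close> is a null section on the neighbourhood \<open>U\<close> of \<open>p\<close>.\<close>

definition null_section ::
  "(real^3) set \<Rightarrow> (real^3 \<Rightarrow> real^2) \<Rightarrow> real^3 \<Rightarrow> (real^3) set \<Rightarrow> (real^3 \<Rightarrow> real^3) \<Rightarrow> bool" where
  "null_section M f p U eta \<longleftrightarrow> open U \<and> p \<in> U \<and> U \<subseteq> M \<and> smooth_on U eta \<and>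
     (\<forall>q\<in>U. eta q \<in> D1 q) \<and> (\<forall>q \<in> Sing M f \<inter> U. span {eta q} = ker_phi f q)"

definition dir_deriv :: "(real^3 \<Rightarrow> real^3) \<Rightarrow> (real^3 \<Rightarrow> real) \<Rightarrow> real^3 \<Rightarrow> real" where
  "dir_deriv eta g q = frechet_derivative g (at q) (eta q)"

text \<open>
  Whether the derivative of \<open>lam f\<close> along a null section vanishes at \<open>p\<close> does not depend on the
  null section (lemma \<open>fold_like_iff\<close> below), so \<open>some\<close> could be replaced by \<open>every\<close> or by any
  given one.
\<close>

definition fold_like :: "(real^3) set \<Rightarrow> (real^3 \<Rightarrow> real^2) \<Rightarrow> real^3 \<Rightarrow> bool" where
  "fold_like M f p \<longleftrightarrow> corank_one_singular M f p \<and>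
     (\<exists>U eta. null_section M f p U eta \<and> dir_deriv eta (lam f) p \<noteq> 0)"

definition hamilton_field :: "(real^3 \<Rightarrow> real) \<Rightarrow> real^3 \<Rightarrow> real^3" where
  "hamilton_field l q =
     (partial 2 l q - q $ 1 * partial 3 l q) *\<^sub>R dx
     - partial 1 l q *\<^sub>R dy
     - (l q - q $ 1 * partial 1 l q) *\<^sub>R dz"

text \<open>Two vectors as a family: \<open>independent {u, v}\<close> alone would accept \<open>u = v \<noteq> 0\<close>.\<close>

definition lin_indep2 :: "'a::real_vector \<Rightarrow> 'a \<Rightarrow> bool" where
  "lin_indep2 u v \<longleftrightarrow> u \<noteq> v \<and> independent {u, v}"

lemma lam_differentiable:
  assumes "open M" "smooth_on M f" "p \<in> M"
  shows "lam f differentiable (at p)"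
proof -
  have d1: "f differentiable (at q)" if "q \<in> M" for q
    using assms(2) that unfolding smooth_on_def by (metis Ck_on.simps(2))
  have d2: "(\<lambda>q. frechet_derivative f (at q) v) differentiable (at p)" for v
    using assms unfolding smooth_on_def by (metis Ck_on.simps(2))
  have pd: "partial i f differentiable (at p)" for i
    using d2 unfolding partial_def by (simp add: fun_eq_iff)
  have c: "(\<lambda>q. partial i f q $ j) differentiable (at p)" for i j
    using pd[of i] bounded_linear.has_derivative[OF bounded_linear_vec_nth[of j]]
    unfolding differentiable_def by blast
  have x: "(\<lambda>q::real^3. q $ 1) differentiable (at p)"
    by (simp add: bounded_linear_imp_differentiable bounded_linear_vec_nth)
  show ?thesis
    unfolding lam_def[abs_def] det_2 transpose_def
    by (auto intro!: differentiable_diff differentiable_mult c x)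
qed

lemma Sing_eq_rank:
  assumes "open M" "smooth_on M f"
  shows "Sing M f = {q \<in> M. rank_phi f q < 2}"
proof -
  have "lam f q = 0 \<longleftrightarrow> rank_phi f q < 2" if "q \<in> M" for q
  proof -
    have "f differentiable (at q)"
      using assms(2) that unfolding smooth_on_def by (metis Ck_on.simps(2))
    then have l: "linear (frechet_derivative f (at q))"
      by (rule linear_frechet_derivative)
    define A :: "real^2^2" where
      "A = vector [partial 1 f q, partial 2 f q - q $ 1 *\<^sub>R partial 3 f q]"
    have "phi f q (e1 q) = partial 1 f q"
      "phi f q (e2 q) = partial 2 f q - q $ 1 *\<^sub>R partial 3 f q"
      using l by (simp_all add: phi_def partial_def e1_def e2_def linear_diff linear_scale)
    moreover have "rows A = range (($) A)"
      by (auto simp: rows_def row_def)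
    then have "rows A = {A $ 1, A $ 2}"
      by (simp only: UNIV_2 image_insert image_empty)
    ultimately have r: "phi f q ` {e1 q, e2 q} = rows A"
      by (simp add: A_def)
    have "phi f q ` D1 q = span (rows A)"
      using l r unfolding D1_def phi_def[abs_def] by (metis linear_span_image)
    then have "rank_phi f q = rank A"
      by (simp add: rank_phi_def row_rank_def flip: row_rank_def)
    moreover have "rank A \<le> 2"
      using rank_bound[of A] by simp
    moreover have "lam f q = det A"
      by (simp add: lam_def A_def det_transpose)
    ultimately show ?thesis
      using full_rank_injective[of A] inj_matrix_vector_mult[of A]
        invertible_det_nz[of A] matrix_left_invertible_injective[of A]
        invertible_left_inverse[of A]
      by auto
  qed
  then show ?thesis unfolding Sing_def by auto
qed

lemma fold_like_iff:
  assumes "open M" "smooth_on M f" "corank_one_singular M f p" "null_section M f p U eta"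
  shows "fold_like M f p \<longleftrightarrow> dir_deriv eta (lam f) p \<noteq> 0"
proof -
  have pM: "p \<in> M" using assms(3) by (simp add: corank_one_singular_def)
  have pS: "p \<in> Sing M f"
    using assms(3) Sing_eq_rank[OF assms(1,2)] by (simp add: corank_one_singular_def)
  have l: "linear (frechet_derivative (lam f) (at p))"
    using lam_differentiable[OF assms(1,2) pM] by (rule linear_frechet_derivative)
  have e: "span {eta p} = ker_phi f p"
    using assms(4) pS by (auto simp: null_section_def)
  have "dir_deriv eta (lam f) p \<noteq> 0"
    if n: "null_section M f p V th" and d: "dir_deriv th (lam f) p \<noteq> 0" for V th
  proof -
    have "span {th p} = ker_phi f p"
      using n pS by (auto simp: null_section_def)
    then have "th p \<in> span {eta p}"
      using e by (metis insertI1 span_base)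
    then obtain c where "th p = c *\<^sub>R eta p"
      by (auto simp: span_singleton)
    then show ?thesis
      using d l by (auto simp: dir_deriv_def linear_scale)
  qed
  then show ?thesis
    using assms(3,4) unfolding fold_like_def by blast
qed

end

(*
  On S the Hamilton field is X = L2 e1 - L1 e2, where L1 and L2 are the derivatives of
  lam along e1 and e2.  For eta = a e1 + b e2 the determinant of (X, eta) with respect to the
  frame e1, e2 is therefore a L1 + b L2, which is the derivative of lam along eta.
*)
theory Submission
  imports Defs
begin

lemma lin_indep2_iff: "lin_indep2 u v \<longleftrightarrow> v \<noteq> 0 \<and> (\<forall>k. u \<noteq> k *\<^sub>R v)"
proof -
  \<comment> \<open>Distinctness is the case \<open>k = 1\<close> of non-proportionality, so it
    needs no separate clause.\<close>
  have "u \<noteq> v" if "\<forall>k. u \<noteq> k *\<^sub>R v"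
    using that[rule_format, of 1] by simp
  then show ?thesis
    by (auto simp: lin_indep2_def independent_insert span_singleton)
qed

text \<open>Coordinates in the family \<open>u\<close>, \<open>v\<close> are unique, so the question
  is whether \<open>(s, t)\<close> and \<open>(a, b)\<close> are independent in the plane, which
  their determinant decides.\<close>

lemma lin_indep2_iff_det:
  assumes "lin_indep2 u v"
  shows "lin_indep2 (s *\<^sub>R u + t *\<^sub>R v) (a *\<^sub>R u + b *\<^sub>R v) \<longleftrightarrow> s * b - t * a \<noteq> 0"
proof -
  have zero: "c *\<^sub>R u + d *\<^sub>R v = 0 \<longleftrightarrow> c = 0 \<and> d = 0" for c d
  proof
    assume *: "c *\<^sub>R u + d *\<^sub>R v = 0"
    have "c = 0"
    proof (rule ccontr)
      assume "c \<noteq> 0"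
      have "c *\<^sub>R u = - d *\<^sub>R v"
        using * by (simp add: add_eq_0_iff2)
      then have "u = (- d / c) *\<^sub>R v"
        using \<open>c \<noteq> 0\<close> vector_fraction_eq_iff[of "- d" c v u] by simp
      then show False
        using assms unfolding lin_indep2_iff by blast
    qed
    then show "c = 0 \<and> d = 0"
      using * assms by (simp add: lin_indep2_iff)
  qed simp
  have "s *\<^sub>R u + t *\<^sub>R v = k *\<^sub>R (a *\<^sub>R u + b *\<^sub>R v) \<longleftrightarrow> s = k * a \<and> t = k * b" for k
    using zero[of "s - k * a" "t - k * b"] by (auto simp: algebra_simps)
  then have "lin_indep2 (s *\<^sub>R u + t *\<^sub>R v) (a *\<^sub>R u + b *\<^sub>R v) \<longleftrightarrow>
      \<not> (a = 0 \<and> b = 0) \<and> (\<forall>k. \<not> (s = k * a \<and> t = k * b))"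
    by (simp add: lin_indep2_iff zero)
  also have "\<dots> \<longleftrightarrow> s * b - t * a \<noteq> 0"
  \<comment> \<open>If \<open>a = 0\<close>, the determinant is \<open>s * b\<close>, and a
    \<open>k\<close> with \<open>t = k * b\<close> exists once \<open>b\<close> is nonzero.
    Otherwise the first coordinates force \<open>k = s / a\<close>.\<close>
  proof (cases "a = 0")
    case True
    moreover have "\<exists>k. t = k * b" if "b \<noteq> 0"
      using that by (intro exI[of _ "t / b"]) simp
    ultimately show ?thesis
      by auto
  next
    case False
    then have "(\<exists>k. s = k * a \<and> t = k * b) \<longleftrightarrow> t = s / a * b"
      by (auto intro!: exI[of _ "s / a"])
    then show ?thesis
      using False by (auto simp: field_simps)
  qed
  finally show ?thesis .
qed

lemma lin_indep2_e1_e2: "lin_indep2 (e1 q) (e2 q)"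
  by (auto simp: lin_indep2_iff e1_def e2_def vec_eq_iff forall_3 axis_def)

text \<open>Where \<open>g\<close> vanishes, the \<open>dz\<close> coefficient reduces to
  \<open>q $ 1 * partial 1 g q\<close>, exactly the \<open>dz\<close> part of
  \<open>- partial 1 g q\<close> times \<open>e2 q\<close>. Hence the field lies in
  \<open>D1 q\<close> there.\<close>

lemma hamilton_field_eq_frame:
  assumes "g q = 0"
  shows "hamilton_field g q =
    (partial 2 g q - q $ 1 * partial 3 g q) *\<^sub>R e1 q + (- partial 1 g q) *\<^sub>R e2 q"
  using assms by (simp add: hamilton_field_def e1_def e2_def algebra_simps)

lemma dir_deriv_frame:
  assumes "g differentiable (at q)" "eta q = a *\<^sub>R e1 q + b *\<^sub>R e2 q"
  shows "dir_deriv eta g q = a * partial 1 g q + b * (partial 2 g q - q $ 1 * partial 3 g q)"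
  using linear_frechet_derivative[OF assms(1)]
  by (simp add: dir_deriv_def assms(2) e1_def e2_def partial_def
      linear_add linear_diff linear_scale)

theorem theorem4p4:
  fixes M U :: "(real^3) set"
    and f :: "real^3 \<Rightarrow> real^2"
    and eta :: "real^3 \<Rightarrow> real^3"
    and p :: "real^3"
  assumes "open M" and "0 \<in> M"
    and "smooth_on M f"
    and "p \<in> Sing M f"
    and "corank_one_singular M f p"
    and "null_section M f p U eta"
  shows "fold_like M f p \<longleftrightarrow> lin_indep2 (hamilton_field (lam f) p) (eta p)"
proof -
  have p: "p \<in> M" "lam f p = 0"
    using assms(4) by (auto simp: Sing_def)
  have "eta p \<in> D1 p"
    using assms(6) by (simp add: null_section_def)
  then obtain a b where eta: "eta p = a *\<^sub>R e1 p + b *\<^sub>R e2 p"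
    by (auto simp: D1_def span_insert span_singleton algebra_simps)
  \<comment> \<open>Passes from some null section to the given \<open>eta\<close>.\<close>
  have "fold_like M f p \<longleftrightarrow> dir_deriv eta (lam f) p \<noteq> 0"
    using fold_like_iff assms by blast
  also have "\<dots> \<longleftrightarrow> lin_indep2 (hamilton_field (lam f) p) (eta p)"
    \<comment> \<open>The minus sign in the \<open>e2\<close> coefficient of the field cancels the
      one in the determinant, so both sides become the same expression.\<close>
    unfolding hamilton_field_eq_frame[of "lam f" p, OF p(2)] eta lin_indep2_iff_det[OF lin_indep2_e1_e2]
      dir_deriv_frame[of "lam f" p eta, OF lam_differentiable[OF assms(1,3) p(1)] eta]
    by (simp add: algebra_simps)
  finally show ?thesis .
qed

end
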